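(* For every $p\geq 2$ there is an integrand $F_p\colon\mathbb{R}^{2\times 2}\to[0,+\infty)$ which is rank-one convex, positively $p$-homogeneous, and not polyconvex at the identity matrix $\mathrm{Id}$.
   Context: An integrand on $\mathbb{R}^{2\times 2}$ is a Borel measurable, locally bounded function $F\colon\mathbb{R}^{2\times 2}\to\mathbb{R}$. $F$ is rank-one convex if $t\mapsto F(A+tX)$ is convex for all $A,X\in\mathbb{R}^{2\times 2}$ with $\mathrm{rank}(X)=1$. $F$ is positively $p$-homogeneous if $F(tA)=t^pF(A)$ for all $A\in\mathbb{R}^{2\times 2}$ and $t>0$. For $A\in\mathbb{R}^{2\times 2}$, $M(A)=(A,\det A)\in\mathbb{R}^{5}$ denotes the vector of all minors of $A$. $F$ is polyconvex at $A$ if there is a convex function $G\colon\mathbb{R}^{5}\to\mathbb{R}$ such that $F(A)=G(M(A))$ and $F\geq G\circ M$ on $\mathbb{R}^{2\times 2}$. *)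

theory Defs
  imports "HOL-Analysis.Analysis"
begin

definition locally_bounded :: "(real^2^2 \<Rightarrow> real) \<Rightarrow> bool" where
  "locally_bounded F \<longleftrightarrow> (\<forall>A. \<exists>U. open U \<and> A \<in> U \<and> bounded (F ` U))"

definition integrand :: "(real^2^2 \<Rightarrow> real) \<Rightarrow> bool" where
  "integrand F \<longleftrightarrow> F \<in> borel_measurable borel \<and> locally_bounded F"

definition rank_one_convex :: "(real^2^2 \<Rightarrow> real) \<Rightarrow> bool" where
  "rank_one_convex F \<longleftrightarrow>
     (\<forall>A X. rank X = 1 \<longrightarrow> convex_on UNIV (\<lambda>t::real. F (A + t *\<^sub>R X)))"

definition pos_homogeneous :: "real \<Rightarrow> (real^2^2 \<Rightarrow> real) \<Rightarrow> bool" where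
  "pos_homogeneous p F \<longleftrightarrow> (\<forall>A. \<forall>t>0. F (t *\<^sub>R A) = t powr p * F A)"

(* The space R^5 of vectors (A, det A) is rendered as the 5-dimensional
   product space (real^2^2) \<times> real. *)
definition minors :: "real^2^2 \<Rightarrow> (real^2^2) \<times> real" where
  "minors A = (A, det A)"

definition polyconvex_at :: "(real^2^2 \<Rightarrow> real) \<Rightarrow> real^2^2 \<Rightarrow> bool" where
  "polyconvex_at F A \<longleftrightarrow>
     (\<exists>G :: (real^2^2) \<times> real \<Rightarrow> real. convex_on UNIV G \<and>
        F A = G (minors A) \<and> (\<forall>B. G (minors B) \<le> F B))"

end

theory Submission
  imports Defs
begin

text \<open>
  Write \<open>S\<close> for the symmetric part of \<open>A\<close> and \<open>w\<close> for the off-diagonal entry of its skew part, so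
  that \<open>det A = det S + w\<^sup>2\<close>. Sverak's function on symmetric matrices, \<open>det S\<close> on positive definite
  \<open>S\<close> and \<open>0\<close> elsewhere, extends to all matrices by adding \<open>w\<^sup>2\<close>. On a rank-one line that meets
  the positive definite cone the extension is \<open>max (det A) (w\<^sup>2)\<close>, on any other it is \<open>w\<^sup>2\<close>; both
  are convex as \<open>det\<close> and \<open>w\<close> are affine there. Its power \<open>p/2\<close> is then rank-one convex and
  \<open>p\<close>-homogeneous. It vanishes at \<open>diag(4,0)\<close>, \<open>diag(0,4)\<close> and \<open>-2 Id\<close>, whose minors average to
  those of \<open>Id\<close> with weights \<open>3/8, 3/8, 1/4\<close>, but not at \<open>Id\<close>.
\<close>

definition skew_entry :: "real^2^2 \<Rightarrow> real" where
  "skew_entry A = (A$1$2 - A$2$1) / 2"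

text \<open>The symmetric part of \<open>A\<close> is definite iff \<open>det A > (skew_entry A)\<^sup>2\<close>; the sign of the trace
  distinguishes positive from negative definite.\<close>

definition sverak_ext :: "real^2^2 \<Rightarrow> real" where
  "sverak_ext A = (if trace A > 0 then max (det A) ((skew_entry A)\<^sup>2) else (skew_entry A)\<^sup>2)"

lemma trace_2: "trace (A :: 'a::semiring_1^2^2) = A$1$1 + A$2$2"
  by (simp add: trace_def sum_2)

lemma sverak_ext_nonneg: "0 \<le> sverak_ext A"
  by (simp add: sverak_ext_def max.coboundedI2)

lemma sverak_ext_scaleR:
  assumes "t > 0"
  shows "sverak_ext (t *\<^sub>R A) = t\<^sup>2 * sverak_ext A"
proof -
  have d: "det (t *\<^sub>R A) = t\<^sup>2 * det A" and s: "(skew_entry (t *\<^sub>R A))\<^sup>2 = t\<^sup>2 * (skew_entry A)\<^sup>2"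
    by (simp_all add: det_2 skew_entry_def power2_eq_square field_simps)
  have "trace (t *\<^sub>R A) = t * trace A"
    by (simp add: trace_2 algebra_simps)
  then have "trace (t *\<^sub>R A) > 0 \<longleftrightarrow> trace A > 0"
    using assms by (simp add: zero_less_mult_iff)
  then show ?thesis
    by (simp add: sverak_ext_def d s max_mult_distrib_left)
qed

text \<open>After multiplication by \<open>a * a'\<close>, the determinant of the sum of two
  positive definite symmetric matrices becomes a positive combination of their determinants plus a
  square.\<close>

lemma pos_definite_2_add:
  fixes a b d a' b' d' :: real
  assumes "b\<^sup>2 < a * d" "0 < a + d" "b'\<^sup>2 < a' * d'" "0 < a' + d'"
  shows "(b + b')\<^sup>2 < (a + a') * (d + d')"
proof -
  have "0 < a * d" "0 < a' * d'"
    using assms by (smt (verit) zero_le_power2)+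
  then have pos: "0 < a" "0 < a'"
    using assms(2,4) by (auto simp: zero_less_mult_iff)
  have "a * a' * ((a + a') * (d + d') - (b + b')\<^sup>2)
      = (a + a') * (a' * (a * d - b\<^sup>2) + a * (a' * d' - b'\<^sup>2)) + (a' * b - a * b')\<^sup>2"
    by (simp add: power2_eq_square algebra_simps)
  also have "\<dots> > 0"
    using pos assms by (intro add_pos_nonneg mult_pos_pos add_pos_pos) auto
  finally have "0 < (a + a') * (d + d') - (b + b')\<^sup>2"
    by (rule zero_less_mult_pos) (use pos in simp)
  then show ?thesis by simp
qed

text \<open>The difference of a positive and a negative definite symmetric part is positive definite.\<close>

lemma det_diff_pos:
  assumes "(skew_entry A)\<^sup>2 < det A" "0 < trace A"
    and "(skew_entry B)\<^sup>2 < det B" "trace B \<le> 0"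
  shows "0 < det (A - B)"
proof -
  define m where "m C = (C$1$2 + C$2$1) / 2" for C :: "real^2^2"
  have det: "det C = C$1$1 * C$2$2 - (m C)\<^sup>2 + (skew_entry C)\<^sup>2" for C
    by (simp add: det_2 skew_entry_def m_def power2_eq_square field_simps)
  have A: "(m A)\<^sup>2 < A$1$1 * A$2$2" and B: "(- m B)\<^sup>2 < (- B$1$1) * (- B$2$2)"
    using assms(1,3) det[of A] det[of B] by simp_all
  \<comment> \<open>A symmetric matrix of trace zero has determinant at most 0. Hence the trace is
    strictly negative and minus the symmetric part of \<open>B\<close> is positive definite.\<close>
  have "trace B \<noteq> 0"
  proof
    assume "trace B = 0"
    then have "B$2$2 = - B$1$1" by (simp add: trace_2)
    then have "(m B)\<^sup>2 + (B$1$1)\<^sup>2 < 0"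
      using B by (simp add: power2_eq_square)
    then show False by (smt (verit) zero_le_power2)
  qed
  then have "(m A + - m B)\<^sup>2 < (A$1$1 + - B$1$1) * (A$2$2 + - B$2$2)"
    using assms(2,4) by (intro pos_definite_2_add[OF A _ B]) (auto simp: trace_2)
  moreover have "m (A - B) = m A + - m B"
    by (simp add: m_def field_simps)
  ultimately show ?thesis
    using det[of "A - B"] by (simp add: add_pos_nonneg)
qed

lemma convex_on_affine: "convex_on UNIV (\<lambda>t::real. a + t * b)"
  by (rule convex_onI) (auto simp: algebra_simps)

lemma convex_on_square_affine:
  "convex_on UNIV (\<lambda>t::real. (a + t * b)\<^sup>2)"
proof (rule f''_ge0_imp_convex)
  show "((\<lambda>t. (a + t * b)\<^sup>2) has_real_derivative 2 * b * (a + t * b)) (at t)" for t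
    by (auto intro!: derivative_eq_intros)
  show "((\<lambda>t. 2 * b * (a + t * b)) has_real_derivative 2 * b * b) (at t)" for t
    by (auto intro!: derivative_eq_intros)
qed auto

lemma convex_on_max:
  fixes f g :: "'a::real_vector \<Rightarrow> real"
  assumes "convex_on S f" "convex_on S g"
  shows "convex_on S (\<lambda>x. max (f x) (g x))"
proof (intro convex_onI)
  show "convex S" using assms(1) by (rule convex_on_imp_convex)
next
  fix t x y assume t: "(0::real) < t" "t < 1" and xy: "x \<in> S" "y \<in> S"
  let ?z = "(1 - t) *\<^sub>R x + t *\<^sub>R y"
  have "f ?z \<le> (1 - t) * f x + t * f y" "g ?z \<le> (1 - t) * g x + t * g y"
    using assms t xy by (auto simp: convex_on_alt intro!: convex_onD)
  moreover have "(1 - t) * f x \<le> (1 - t) * max (f x) (g x)" "t * f y \<le> t * max (f y) (g y)"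
    "(1 - t) * g x \<le> (1 - t) * max (f x) (g x)" "t * g y \<le> t * max (f y) (g y)"
    using t by (auto intro!: mult_left_mono)
  ultimately show "max (f ?z) (g ?z) \<le> (1 - t) * max (f x) (g x) + t * max (f y) (g y)"
    by linarith
qed

lemma rank_one_convex_sverak_ext: "rank_one_convex sverak_ext"
  unfolding rank_one_convex_def
proof (intro allI impI)
  fix A X :: "real^2^2"
  assume "rank X = 1"
  then have X: "det X = 0"
    by (simp add: det_eq_0_rank)
  define L where "L t = A + t *\<^sub>R X" for t :: real
  have skew: "convex_on UNIV (\<lambda>t. (skew_entry (L t))\<^sup>2)"
  proof -
    have "skew_entry (L t) = skew_entry A + t * skew_entry X" for t
      by (simp add: skew_entry_def L_def field_simps)
    then show ?thesis by (simp add: convex_on_square_affine)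
  qed
  \<comment> \<open>Along the line the determinant is quadratic with leading coefficient
    \<open>det X\<close>, hence affine.\<close>
  have "det (L t) = det A + t * (A$1$1 * X$2$2 + X$1$1 * A$2$2 - A$1$2 * X$2$1 - X$1$2 * A$2$1)
      + t\<^sup>2 * det X" for t
    by (simp add: det_2 L_def power2_eq_square algebra_simps)
  then have det: "convex_on UNIV (\<lambda>t. det (L t))"
    by (simp add: X convex_on_affine)
  have "convex_on UNIV (\<lambda>t. sverak_ext (L t))"
  proof (cases "\<exists>s. trace (L s) > 0 \<and> (skew_entry (L s))\<^sup>2 < det (L s)")
    case True
    then obtain s where s: "trace (L s) > 0" "(skew_entry (L s))\<^sup>2 < det (L s)" by blast
    \<comment> \<open>Symmetric parts on this line are never negative definite:
      \<open>L s - L t\<close> is a multiple of the singular \<open>X\<close>, against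
      \<open>det_diff_pos\<close>. So the \<open>max\<close> formula also holds where the trace is
      not positive.\<close>
    have "det (L t) \<le> (skew_entry (L t))\<^sup>2" if "trace (L t) \<le> 0" for t
    proof (rule ccontr)
      assume "\<not> det (L t) \<le> (skew_entry (L t))\<^sup>2"
      then have "0 < det (L s - L t)"
        using s that by (intro det_diff_pos) auto
      moreover have "det (L s - L t) = (s - t)\<^sup>2 * det X"
        by (simp add: det_2 L_def power2_eq_square algebra_simps)
      ultimately show False by (simp add: X)
    qed
    then have "sverak_ext (L t) = max (det (L t)) ((skew_entry (L t))\<^sup>2)" for t
      by (auto simp: sverak_ext_def)
    then show ?thesis
      using convex_on_max[OF det skew] by simp
  next
    case False
    then have "sverak_ext (L t) = (skew_entry (L t))\<^sup>2" for t
      by (auto simp: sverak_ext_def max_def not_less intro: antisym)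
    then show ?thesis using skew by simp
  qed
  then show "convex_on UNIV (\<lambda>t. sverak_ext (A + t *\<^sub>R X))"
    by (simp add: L_def)
qed

text \<open>For positive \<open>u\<close> and \<open>v\<close> this is convexity of the power. If
  one of them is 0, it reduces to \<open>c powr q \<le> c\<close> for \<open>c\<close> between 0 and
  1.\<close>

lemma powr_convex_comb:
  fixes u v t q :: real
  assumes "0 \<le> u" "0 \<le> v" "0 < t" "t < 1" "1 \<le> q"
  shows "((1 - t) * u + t * v) powr q \<le> (1 - t) * u powr q + t * v powr q"
proof -
  have "(c * w) powr q \<le> c * w powr q" if "0 < c" "c < 1" "0 \<le> w" for c w :: real
  proof -
    have "c powr q \<le> c powr 1"
      using that assms by (intro powr_mono') auto
    then show ?thesis
      using that by (simp add: powr_mult mult_right_mono)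
  qed
  then show ?thesis
    using assms convex_onD[OF powr_convex[OF assms(5)], of t u v]
    by (cases "u = 0"; cases "v = 0") auto
qed

lemma convex_on_powr:
  fixes f :: "'a::real_vector \<Rightarrow> real"
  assumes "convex_on S f" "\<And>x. x \<in> S \<Longrightarrow> 0 \<le> f x" "1 \<le> q"
  shows "convex_on S (\<lambda>x. f x powr q)"
proof (intro convex_onI)
  show "convex S" using assms(1) by (rule convex_on_imp_convex)
next
  fix t x y assume t: "(0::real) < t" "t < 1" and xy: "x \<in> S" "y \<in> S"
  let ?z = "(1 - t) *\<^sub>R x + t *\<^sub>R y"
  have "?z \<in> S"
    using convex_on_imp_convex[OF assms(1)] t xy by (auto simp: convex_alt)
  moreover have "f ?z \<le> (1 - t) * f x + t * f y"
    using assms(1) t xy by (intro convex_onD) auto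
  ultimately have "f ?z powr q \<le> ((1 - t) * f x + t * f y) powr q"
    using assms by (intro powr_mono2) auto
  also have "\<dots> \<le> (1 - t) * f x powr q + t * f y powr q"
    using assms t xy by (intro powr_convex_comb) auto
  finally show "f ?z powr q \<le> (1 - t) * f x powr q + t * f y powr q" .
qed

lemma locally_bounded_dominated:
  assumes "continuous_on UNIV h" "\<And>A. \<bar>F A\<bar> \<le> h A"
  shows "locally_bounded F"
  unfolding locally_bounded_def
proof
  fix A
  have "compact (h ` cball A 1)"
    using assms(1) by (intro compact_continuous_image) (auto intro: continuous_on_subset)
  then obtain c where "\<And>B. B \<in> cball A 1 \<Longrightarrow> h B \<le> c"
    by (metis bounded_real compact_imp_bounded abs_le_D1 imageI)
  then have "bounded (F ` ball A 1)"
    unfolding bounded_real using assms(2) by (intro exI[of _ c]) (force intro: order_trans)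
  then show "\<exists>U. open U \<and> A \<in> U \<and> bounded (F ` U)"
    by (intro exI[of _ "ball A 1"]) auto
qed

lemma borel_measurable_sverak_ext: "sverak_ext \<in> borel_measurable borel"
proof -
  have [measurable]: "(\<lambda>A::real^2^2. A$i$j) \<in> borel_measurable borel" for i j
    by (intro borel_measurable_continuous_onI continuous_intros)
  show ?thesis
    unfolding sverak_ext_def trace_2 det_2 skew_entry_def by measurable
qed

text \<open>The convex \<open>G\<close> lies below \<open>F\<close>, hence below \<open>b\<close>,
  at the minors of \<open>S\<close>, and keeps this bound on their convex hull, where it meets
  \<open>F\<close> at \<open>A\<close>.\<close>

lemma polyconvex_at_le:
  assumes "polyconvex_at F A" "minors A \<in> convex hull (minors ` S)" "\<And>B. B \<in> S \<Longrightarrow> F B \<le> b"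
  shows "F A \<le> b"
proof -
  obtain G where G: "convex_on UNIV G" "F A = G (minors A)" "\<And>B. G (minors B) \<le> F B"
    using assms(1) unfolding polyconvex_at_def by blast
  have "convex_on (convex hull (minors ` S)) G"
    using G(1) by (rule convex_on_subset) auto
  moreover have "\<forall>x\<in>minors ` S. G x \<le> b"
    by (auto intro: order_trans[OF G(3) assms(3)])
  ultimately have "\<forall>x\<in>convex hull (minors ` S). G x \<le> b"
    by (rule convex_on_convex_hull_bound)
  then show ?thesis
    using assms(2) G(2) by metis
qed

theorem proposition3p7:
  fixes p :: real
  assumes "p \<ge> 2"
  shows "\<exists>F :: real^2^2 \<Rightarrow> real. integrand F \<and> (\<forall>A. 0 \<le> F A) \<and> rank_one_convex F \<and>
           pos_homogeneous p F \<and> \<not> polyconvex_at F (mat 1)"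
proof -
  \<comment> \<open>Halving \<open>p\<close> compensates for the 2-homogeneity of
    \<open>sverak_ext\<close>; \<open>p \<ge> 2\<close> makes the exponent at least 1, so that the
    power preserves convexity.\<close>
  define F where "F A = sverak_ext A powr (p / 2)" for A
  have "locally_bounded F"
  proof (rule locally_bounded_dominated)
    show "continuous_on UNIV (\<lambda>A::real^2^2. (\<bar>det A\<bar> + (skew_entry A)\<^sup>2) powr (p / 2))"
      using assms unfolding det_2 skew_entry_def
      by (intro continuous_on_powr' continuous_intros) auto
    have "sverak_ext A \<le> \<bar>det A\<bar> + (skew_entry A)\<^sup>2" for A
      by (auto simp: sverak_ext_def intro: order_trans[OF abs_ge_self])
    then show "\<bar>F A\<bar> \<le> (\<bar>det A\<bar> + (skew_entry A)\<^sup>2) powr (p / 2)" for A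
      using assms by (simp add: F_def powr_mono2 sverak_ext_nonneg)
  qed
  moreover have "F \<in> borel_measurable borel"
    unfolding F_def using borel_measurable_sverak_ext by measurable
  moreover have "rank_one_convex F"
    using rank_one_convex_sverak_ext assms
    by (auto simp: rank_one_convex_def F_def sverak_ext_nonneg intro!: convex_on_powr)
  moreover have "pos_homogeneous p F"
    unfolding pos_homogeneous_def
  proof (intro allI impI)
    fix A :: "real^2^2" and t :: real assume t: "t > 0"
    then have "t\<^sup>2 powr (p / 2) = t powr p"
      by (simp add: powr_powr flip: powr_numeral)
    then show "F (t *\<^sub>R A) = t powr p * F A"
      using t by (simp add: F_def sverak_ext_scaleR powr_mult sverak_ext_nonneg)
  qed
  moreover have "\<not> polyconvex_at F (mat 1)"
  proof
    assume poly: "polyconvex_at F (mat 1)"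
    define B1 B2 B3 :: "real^2^2" where "B1 = vector [vector [4, 0], vector [0, 0]]"
      and "B2 = vector [vector [0, 0], vector [0, 4]]" and "B3 = - 2 *\<^sub>R mat 1"
    note B = B1_def B2_def B3_def
    have "minors (mat 1)
        = (3/8) *\<^sub>R minors B1 + (3/8) *\<^sub>R minors B2 + (1/4) *\<^sub>R minors B3"
      by (simp add: minors_def B det_2 vec_eq_iff forall_2 mat_def)
    then have "minors (mat 1) \<in> convex hull (minors ` {B1, B2, B3})"
      unfolding image_insert image_empty convex_hull_3
      by (intro CollectI exI[of _ "3/8"] exI[of _ "1/4"]) auto
    \<comment> \<open>All three matrices are symmetric. \<open>B1\<close> and \<open>B2\<close> are
      singular, while \<open>B3\<close> has determinant 4 but negative trace.\<close>
    moreover have "sverak_ext B1 = 0" "sverak_ext B2 = 0" "sverak_ext B3 = 0"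
      by (simp_all add: sverak_ext_def skew_entry_def B det_2 trace_2 mat_def)
    then have "F B \<le> 0" if "B \<in> {B1, B2, B3}" for B
      using that by (auto simp: F_def)
    ultimately have "F (mat 1) \<le> 0"
      by (intro polyconvex_at_le[OF poly, of "{B1, B2, B3}"])
    moreover have "F (mat 1) = 1"
      by (simp add: F_def sverak_ext_def skew_entry_def det_2 trace_2 mat_def)
    ultimately show False by simp
  qed
  ultimately show ?thesis
    unfolding integrand_def by (intro exI[of _ F]) (auto simp: F_def)
qed

end
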